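(* Let $T\subset S^dU$ be a special vector space of height $\lambda$, apex $h$ and partition $(\gamma_1,\gamma_2,\dots,\gamma_r)$. Then, for every integer $k\in[2,\lambda]$, the number $$q(k)=\dim\left[\frac{p_{k-1}(\partial^{\lambda-k}(h))}{D_k(S^kU\otimes T)\cap p_{k-1}(\partial^{\lambda-k}(h))}\right]$$ is equal to the number of covering generators of $p_{k-1}(\partial^{\lambda-k}(h))$.
   Context: Work over $\mathbb{C}$. $U=\langle x,y\rangle$ is a 2-dimensional vector space and $S^nU$ is identified with homogeneous polynomials of degree $n$ in $x,y$. For a subspace $W\subset S^nU$, $\partial W\subset S^{n-1}U$ is the span of $\partial_x(W)$ and $\partial_y(W)$, and $\partial^kW$ is the $k$-fold iterate ($\partial^0W=W$); for a polynomial $g$, $\partial^k(g)$ means $\partial^k\langle g\rangle$. $D_k:S^kU\otimes S^dU\to S^{k-1}U\otimes S^{d-1}U$ is $D_k=\partial_x\otimes\partial_y-\partial_y\otimes\partial_x$. The polarization map $p_k:S^nU\to S^kU\otimes S^{n-k}U$ ($n\ge k$) is the (injective) linear map $p_k(g)=\frac{(n-k)!}{n!}\sum_{i=0}^k\binom{k}{i}x^{k-i}y^i\otimes\partial_x^{k-i}\partial_y^i(g)$. Special vector space: $T\subset S^dU$ is special if there are an integer $r\ge 2$ and integers $2\le\alpha_1\le\beta_1<\alpha_2\le\beta_2<\dots<\alpha_r\le\beta_r\le d-2$ with $\alpha_{i+1}=\beta_i+2$ for $i=1,\dots,r-1$, such that $T$ is spanned by the monomials $x^{d-j}y^j$ with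 $j\in\bigcup_{i=1}^r[\alpha_i,\beta_i]$. Equivalently, $T=\partial^{\gamma_1-2}(m_1)\oplus\cdots\oplus\partial^{\gamma_r-2}(m_r)$ where $m_i=x^{d-\alpha_i}y^{\beta_i}$ (of degree $d+\gamma_i-2$) and $\gamma_i=\beta_i-\alpha_i+2\ge 2$, and $\partial T=\partial^{\lambda-1}(h)$ where $h=x^{d-\alpha_1}y^{\beta_r}$ and $\lambda=\gamma_1+\cdots+\gamma_r=\beta_r-\alpha_1+2$. Then $\lambda$ is the height of $T$, $h$ (of degree $d+\lambda-2$) its apex, and $(\gamma_1,\dots,\gamma_r)$ its associated partition. Covering generators: the space $\partial T=\partial^{\lambda-1}(h)$ has the ordered basis $\partial_y^{\lambda-1}(h),\partial_x\partial_y^{\lambda-2}(h),\dots,\partial_x^{\lambda-1}(h)$, whose elements are indexed by $1,2,\dots,\lambda$ in this order. The generators of $p_{k-1}(\partial^{\lambda-k}(h))$ are the $\lambda-k+1$ linearly independent elements $p_{k-1}(\partial_x^j\partial_y^{\lambda-k-j}(h))$, $j=0,\dots,\lambda-k$. The $j$-th of these is a sum of tensor products of monomials in $S^{k-1}U$ with exactly the $k$ consecutive basis elements of $\partial T$ having indices in $\{j+1,\dots,j+k\}$. The partition $\gamma_1+\cdots+\gamma_r=\lambda$ divides $\{1,\dots,\lambda\}$ into the consecutive blocks $\{1,\dots,\gamma_1\},\{\gamma_1+1,\dots,\gamma_1+\gamma_2\},\dots,\{\gamma_1+\cdots+\gamma_{r-1}+1,\dots,\lambda\}$. The $j$-th generator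 is called a covering generator if $\{j+1,\dots,j+k\}$ contains at least one of these blocks. *)

theory Defs
  imports Complex_Main "HOL-Library.Poly_Mapping" "HOL-Library.Set_Algebras"
begin

section \<open>Vector spaces of polynomials\<close>

definition scal :: "complex \<Rightarrow> ('m \<Rightarrow>\<^sub>0 complex) \<Rightarrow> 'm \<Rightarrow>\<^sub>0 complex"
  where "scal c f = Poly_Mapping.map ((*) c) f"

lemma lookup_scal: "Poly_Mapping.lookup (scal c f) m = c * Poly_Mapping.lookup f m"
  by (simp add: scal_def Poly_Mapping.map.rep_eq when_def)

global_interpretation pm: vector_space "scal :: complex \<Rightarrow> ('m \<Rightarrow>\<^sub>0 complex) \<Rightarrow> _"
  by unfold_locales
    (auto intro!: poly_mapping_eqI simp: lookup_scal lookup_add algebra_simps)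

text \<open>
  The key \<open>(a, b)\<close> stands for the monomial \<open>x\<^sup>a y\<^sup>b\<close>.  The tensor product of two copies of
  the polynomial space is taken to be the free vector space on pairs of monomials:
  the key \<open>(m, n)\<close> stands for \<open>m \<otimes> n\<close>.
\<close>

type_synonym bpoly = "(nat \<times> nat) \<Rightarrow>\<^sub>0 complex"
type_synonym btensor = "((nat \<times> nat) \<times> (nat \<times> nat)) \<Rightarrow>\<^sub>0 complex"

definition monom_xy :: "nat \<Rightarrow> nat \<Rightarrow> bpoly"
  where "monom_xy a b = Poly_Mapping.single (a, b) 1"

definition Sym :: "nat \<Rightarrow> bpoly set"
  where "Sym n = {f. \<forall>(a, b) \<in> Poly_Mapping.keys f. a + b = n}"

definition dx :: "bpoly \<Rightarrow> bpoly"
  where "dx f = (\<Sum>(a, b)\<in>Poly_Mapping.keys f.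
    Poly_Mapping.single (a - 1, b) (of_nat a * Poly_Mapping.lookup f (a, b)))"

definition dy :: "bpoly \<Rightarrow> bpoly"
  where "dy f = (\<Sum>(a, b)\<in>Poly_Mapping.keys f.
    Poly_Mapping.single (a, b - 1) (of_nat b * Poly_Mapping.lookup f (a, b)))"

definition partial :: "bpoly set \<Rightarrow> bpoly set"
  where "partial W = pm.span (dx ` W \<union> dy ` W)"

definition partial_pow :: "nat \<Rightarrow> bpoly \<Rightarrow> bpoly set"
  where "partial_pow k g = (partial ^^ k) (pm.span {g})"

definition tensor :: "bpoly \<Rightarrow> bpoly \<Rightarrow> btensor"
  where "tensor f g = (\<Sum>m\<in>Poly_Mapping.keys f. \<Sum>n\<in>Poly_Mapping.keys g.
    Poly_Mapping.single (m, n) (Poly_Mapping.lookup f m * Poly_Mapping.lookup g n))"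

definition tensor_space :: "bpoly set \<Rightarrow> bpoly set \<Rightarrow> btensor set"
  where "tensor_space V W = pm.span {tensor f g |f g. f \<in> V \<and> g \<in> W}"

text \<open>The linear map \<open>A \<otimes> B\<close>, for linear \<open>A\<close> and \<open>B\<close>.\<close>

definition tensor_map :: "(bpoly \<Rightarrow> bpoly) \<Rightarrow> (bpoly \<Rightarrow> bpoly) \<Rightarrow> btensor \<Rightarrow> btensor"
  where "tensor_map A B t =
    (\<Sum>(m, n)\<in>Poly_Mapping.keys t. scal (Poly_Mapping.lookup t (m, n))
       (tensor (A (Poly_Mapping.single m 1)) (B (Poly_Mapping.single n 1))))"

text \<open>
  \<open>D_map\<close> is defined on the whole tensor product; \<open>D\<^sub>k\<close> is its restriction to
  \<open>Sym k \<otimes> Sym d\<close>.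
\<close>

definition D_map :: "btensor \<Rightarrow> btensor"
  where "D_map t = tensor_map dx dy t - tensor_map dy dx t"

text \<open>The polarization \<open>p\<^sub>k\<close> on \<open>Sym n\<close>, for \<open>k \<le> n\<close>.\<close>

definition polar :: "nat \<Rightarrow> nat \<Rightarrow> bpoly \<Rightarrow> btensor"
  where "polar n k g = scal (fact (n - k) / fact n)
    (\<Sum>i=0..k. scal (of_nat (k choose i))
       (tensor (monom_xy (k - i) i) ((dx ^^ (k - i)) ((dy ^^ i) g))))"


section \<open>Dimension of a quotient space\<close>

text \<open>
  \<open>V/N\<close> is the set of cosets \<open>v + N\<close>.  In \<open>quot_lincomb\<close> the sum is the sum of subsets of
  the ambient space; the summand \<open>N\<close> makes the result a coset of \<open>N\<close> also when the
  index set is empty or some coefficient is 0.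
\<close>

definition quot_space :: "('m \<Rightarrow>\<^sub>0 complex) set \<Rightarrow> ('m \<Rightarrow>\<^sub>0 complex) set \<Rightarrow> ('m \<Rightarrow>\<^sub>0 complex) set set"
  where "quot_space V N = (\<lambda>v. v +o N) ` V"

definition quot_lincomb ::
  "('m \<Rightarrow>\<^sub>0 complex) set \<Rightarrow> (('m \<Rightarrow>\<^sub>0 complex) set \<Rightarrow> complex) \<Rightarrow> ('m \<Rightarrow>\<^sub>0 complex) set set \<Rightarrow> ('m \<Rightarrow>\<^sub>0 complex) set"
  where "quot_lincomb N c B = N + (\<Sum>X\<in>B. scal (c X) ` X)"

definition quot_basis ::
  "('m \<Rightarrow>\<^sub>0 complex) set \<Rightarrow> ('m \<Rightarrow>\<^sub>0 complex) set \<Rightarrow> ('m \<Rightarrow>\<^sub>0 complex) set set \<Rightarrow> bool"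
  where "quot_basis V N B \<longleftrightarrow>
    finite B \<and> B \<subseteq> quot_space V N \<and>
    (\<forall>c. quot_lincomb N c B = N \<longrightarrow> (\<forall>X\<in>B. c X = 0)) \<and>
    (\<forall>Y\<in>quot_space V N. \<exists>c. Y = quot_lincomb N c B)"

text \<open>As for \<^term>\<open>pm.dim\<close>, the value is 0 if there is no finite basis.\<close>

definition quot_dim :: "('m \<Rightarrow>\<^sub>0 complex) set \<Rightarrow> ('m \<Rightarrow>\<^sub>0 complex) set \<Rightarrow> nat"
  where "quot_dim V N =
    (if \<exists>B. quot_basis V N B then card (SOME B. quot_basis V N B) else 0)"


section \<open>Special vector spaces\<close>

text \<open>
  \<open>special d r \<alpha> \<beta> T\<close>: \<open>T\<close> is the special subspace of \<open>Sym d\<close> given by \<open>\<alpha>\<^sub>1, \<beta>\<^sub>1, \<dots>, \<alpha>\<^sub>r, \<beta>\<^sub>r\<close>.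
  Only the values of \<open>\<alpha>\<close> and \<open>\<beta>\<close> on \<open>{1..r}\<close> matter, and \<open>T\<close> determines \<open>r\<close> and these values.
\<close>

definition special :: "nat \<Rightarrow> nat \<Rightarrow> (nat \<Rightarrow> nat) \<Rightarrow> (nat \<Rightarrow> nat) \<Rightarrow> bpoly set \<Rightarrow> bool"
  where "special d r \<alpha> \<beta> T \<longleftrightarrow>
    2 \<le> r \<and> 2 \<le> \<alpha> 1 \<and> \<beta> r \<le> d - 2 \<and>
    (\<forall>i\<in>{1..r}. \<alpha> i \<le> \<beta> i) \<and>
    (\<forall>i\<in>{1..<r}. \<beta> i < \<alpha> (i + 1) \<and> \<alpha> (i + 1) = \<beta> i + 2) \<and>
    T = pm.span ((\<lambda>j. monom_xy (d - j) j) ` (\<Union>i\<in>{1..r}. {\<alpha> i..\<beta> i}))"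

definition part :: "(nat \<Rightarrow> nat) \<Rightarrow> (nat \<Rightarrow> nat) \<Rightarrow> nat \<Rightarrow> nat"
  where "part \<alpha> \<beta> i = \<beta> i - \<alpha> i + 2"

definition height :: "nat \<Rightarrow> (nat \<Rightarrow> nat) \<Rightarrow> nat"
  where "height r \<gamma> = (\<Sum>i=1..r. \<gamma> i)"

definition apex :: "nat \<Rightarrow> nat \<Rightarrow> (nat \<Rightarrow> nat) \<Rightarrow> (nat \<Rightarrow> nat) \<Rightarrow> bpoly"
  where "apex d r \<alpha> \<beta> = monom_xy (d - \<alpha> 1) (\<beta> r)"

definition special_with ::
  "nat \<Rightarrow> bpoly set \<Rightarrow> nat \<Rightarrow> bpoly \<Rightarrow> nat \<Rightarrow> (nat \<Rightarrow> nat) \<Rightarrow> bool"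
  where "special_with d T l h r \<gamma> \<longleftrightarrow>
    (\<exists>\<alpha> \<beta>. special d r \<alpha> \<beta> T \<and> h = apex d r \<alpha> \<beta> \<and>
       (\<forall>i\<in>{1..r}. \<gamma> i = part \<alpha> \<beta> i) \<and> l = height r \<gamma>)"


section \<open>Covering generators\<close>

text \<open>
  In the parameters below \<open>l\<close> is the height, so that the apex \<open>h\<close> has degree \<open>d + l - 2\<close> and
  \<open>\<partial>\<^bsup>l-k\<^esup>(h)\<close> consists of forms of degree \<open>d + k - 2\<close>.
\<close>

definition generator :: "nat \<Rightarrow> nat \<Rightarrow> bpoly \<Rightarrow> nat \<Rightarrow> nat \<Rightarrow> btensor"
  where "generator d l h k j = polar (d + k - 2) (k - 1) ((dx ^^ j) ((dy ^^ (l - k - j)) h))"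

definition block :: "(nat \<Rightarrow> nat) \<Rightarrow> nat \<Rightarrow> nat set"
  where "block \<gamma> i = {(\<Sum>s=1..<i. \<gamma> s) + 1..(\<Sum>s=1..i. \<gamma> s)}"

definition covering_generators ::
  "nat \<Rightarrow> nat \<Rightarrow> bpoly \<Rightarrow> nat \<Rightarrow> (nat \<Rightarrow> nat) \<Rightarrow> nat \<Rightarrow> btensor set"
  where "covering_generators d l h r \<gamma> k =
    generator d l h k ` {j \<in> {0..l - k}. \<exists>i\<in>{1..r}. block \<gamma> i \<subseteq> {j + 1..j + k}}"

definition polar_space :: "nat \<Rightarrow> nat \<Rightarrow> bpoly \<Rightarrow> nat \<Rightarrow> btensor set"
  where "polar_space d l h k = polar (d + k - 2) (k - 1) ` partial_pow (l - k) h"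

definition q :: "nat \<Rightarrow> bpoly set \<Rightarrow> nat \<Rightarrow> bpoly \<Rightarrow> nat \<Rightarrow> nat"
  where "q d T l h k = quot_dim (polar_space d l h k)
    (D_map ` tensor_space (Sym k) T \<inter> polar_space d l h k)"

end

(* Attach to the coefficient of a tensor at x^a y^b (x) x^c y^e the weight a! b! c! e!.  In these
   coordinates D_k becomes a difference operator along the line of fixed total y-degree, and the
   generator p_{k-1}(monomial) is a constant function on its window of k consecutive basis elements
   of dT.  Membership of a generator in the image of D_k thus asks for a function u vanishing at the
   exponents missing from T (the borders of the blocks) whose difference is constant on the window.
   If the window contains a block, u would take equal values at the two ends of this block, so the
   sum of the differences over the block is zero: this sum is a functional killing the image but not
   the generator.  Otherwise there is at most one missing exponent m_0 in reach, and u(m) = m - m_0 works.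
   Since the generators have disjoint supports, the quotient has the covering generators as a basis. *)

theory Submission
  imports Defs
begin

section \<open>Dimension of a quotient by biorthogonality\<close>

text \<open>The summand \<open>N\<close> in \<open>quot_lincomb\<close> absorbs the
  \<open>N\<close>-parts of all cosets. It also covers \<open>c X = 0\<close>, where the scaled
  coset shrinks to zero.\<close>

lemma quot_lincomb_coset:
  assumes N: "pm.subspace N" and "finite B" and "\<And>X. X \<in> B \<Longrightarrow> v X +o N = X"
  shows "quot_lincomb N c B = (\<Sum>X\<in>B. scal (c X) (v X)) +o N"
proof -
  have step: "(w +o N) + scal a ` (u +o N) = (w + scal a u) +o N" for w a u
  proof (intro subset_antisym subsetI)
    fix z assume "z \<in> (w +o N) + scal a ` (u +o N)"
    then obtain m n where "m \<in> N" "n \<in> N" "z = (w + m) + scal a (u + n)"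
      by (auto simp: set_plus_def elt_set_plus_def)
    moreover have "m + scal a n \<in> N"
      using N calculation by (simp add: pm.subspace_add pm.subspace_scale)
    ultimately show "z \<in> (w + scal a u) +o N"
      by (auto simp: elt_set_plus_def pm.scale_right_distrib algebra_simps)
  next
    fix z assume "z \<in> (w + scal a u) +o N"
    \<comment> \<open>The whole \<open>N\<close>-part goes into the first coset, since for
      \<open>a = 0\<close> the second one cannot supply it.\<close>
    then obtain n where n: "n \<in> N" "z = (w + n) + scal a (u + 0)"
      by (auto simp: elt_set_plus_def algebra_simps)
    have "w + n \<in> w +o N" "u + 0 \<in> u +o N"
      using n(1) pm.subspace_0[OF N] by (auto simp: elt_set_plus_def simp del: add_0_right)
    then show "z \<in> (w +o N) + scal a ` (u +o N)"
      unfolding n(2) by (intro set_plus_intro imageI)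
  qed
  show ?thesis
    using assms(2,3)
  proof (induction B rule: finite_induct)
    case empty
    then show ?case by (simp add: quot_lincomb_def set_zero_plus2 elt_set_plus_def)
  next
    case (insert X B)
    have "quot_lincomb N c (insert X B) = quot_lincomb N c B + scal (c X) ` X"
      unfolding quot_lincomb_def using insert.hyps by (simp add: add.assoc add.left_commute add.commute)
    also have "\<dots> = ((\<Sum>X\<in>B. scal (c X) (v X)) +o N) + scal (c X) ` (v X +o N)"
      using insert by simp
    also note step
    also have "(\<Sum>X\<in>B. scal (c X) (v X)) + scal (c X) (v X) = (\<Sum>X\<in>insert X B. scal (c X) (v X))"
      using insert.hyps by (simp add: add.commute)
    finally show ?case .
  qed
qed

lemma coset_eq_iff:
  assumes N: "pm.subspace N"
  shows "u +o N = w +o N \<longleftrightarrow> u - w \<in> N"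
proof
  assume "u +o N = w +o N"
  moreover have "u \<in> u +o N"
    using pm.subspace_0[OF N] by (force simp: elt_set_plus_def)
  ultimately show "u - w \<in> N" by (auto simp: elt_set_plus_def)
next
  assume *: "u - w \<in> N"
  have "\<exists>n'\<in>N. u + n = w + n'" if "n \<in> N" for n
    using pm.subspace_add[OF N * that] by (intro bexI[of _ "u - w + n"]) auto
  moreover have "\<exists>n'\<in>N. w + n = u + n'" if "n \<in> N" for n
    using pm.subspace_diff[OF N that *] by (intro bexI[of _ "n - (u - w)"]) auto
  ultimately show "u +o N = w +o N"
    unfolding elt_set_plus_def by blast
qed

lemma coset_eq_self_iff: "pm.subspace N \<Longrightarrow> u +o N = N \<longleftrightarrow> u \<in> N"
  using coset_eq_iff[of N u 0] by simp

text \<open>Choosing representatives turns the coset conditions into linear algebra modulo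
  \<open>N\<close> in the ambient space.\<close>

lemma quot_basis_iff:
  assumes N: "pm.subspace N" and fin: "finite B"
    and v: "\<And>X. X \<in> B \<Longrightarrow> v X \<in> V \<and> v X +o N = X"
  shows "quot_basis V N B \<longleftrightarrow>
    (\<forall>c. (\<Sum>X\<in>B. scal (c X) (v X)) \<in> N \<longrightarrow> (\<forall>X\<in>B. c X = 0)) \<and>
    (\<forall>y\<in>V. \<exists>c. y - (\<Sum>X\<in>B. scal (c X) (v X)) \<in> N)"
proof -
  have "B \<subseteq> quot_space V N"
    unfolding quot_space_def using v by (metis imageI subsetI)
  moreover have "quot_lincomb N c B = (\<Sum>X\<in>B. scal (c X) (v X)) +o N" for c
    by (rule quot_lincomb_coset[OF N fin]) (simp add: v)
  ultimately show ?thesis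
    unfolding quot_basis_def using fin
    by (auto simp: coset_eq_self_iff[OF N] coset_eq_iff[OF N] quot_space_def)
qed

text \<open>Lifts of \<open>B\<close> extend \<open>A\<close> to a second basis of the span of
  \<open>A \<union> C\<close>, so comparing cardinalities gives the claim. It makes
  \<open>quot_dim\<close> independent of the basis chosen by \<open>SOME\<close>.\<close>

lemma quot_basis_card:
  assumes fin: "finite A" "finite C" and disj: "A \<inter> C = {}" and ind: "pm.independent (A \<union> C)"
    and B: "quot_basis (pm.span (A \<union> C)) (pm.span A) B"
  shows "card B = card C"
proof -
  let ?V = "pm.span (A \<union> C)" and ?N = "pm.span A"
  have N: "pm.subspace ?N" by (rule pm.subspace_span)
  have finB: "finite B" and Bsub: "B \<subseteq> quot_space ?V ?N"
    using B by (auto simp: quot_basis_def)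
  then have "\<forall>X\<in>B. \<exists>u. u \<in> ?V \<and> u +o ?N = X"
    unfolding quot_space_def by blast
  then obtain v where v: "\<And>X. X \<in> B \<Longrightarrow> v X \<in> ?V \<and> v X +o ?N = X"
    by metis
  have indep: "\<And>c. (\<Sum>X\<in>B. scal (c X) (v X)) \<in> ?N \<Longrightarrow> \<forall>X\<in>B. c X = 0"
    and gen: "\<And>y. y \<in> ?V \<Longrightarrow> \<exists>c. y - (\<Sum>X\<in>B. scal (c X) (v X)) \<in> ?N"
    using B quot_basis_iff[OF N finB v] by auto
  have inj: "inj_on v B"
    by (rule inj_onI) (use v in metis)
  \<comment> \<open>A lift lying in \<open>A\<close> would be zero in the quotient, contradicting
    independence for the indicator coefficients of that lift.\<close>
  have disj': "A \<inter> v ` B = {}"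
  proof (rule ccontr)
    assume "A \<inter> v ` B \<noteq> {}"
    then obtain X where X: "X \<in> B" "v X \<in> A" by auto
    have "(\<Sum>Y\<in>B. scal (if Y = X then 1 else 0) (v Y)) = (\<Sum>Y\<in>B. if Y = X then v Y else 0)"
      by (intro sum.cong) auto
    also have "\<dots> = v X"
      using X finB by simp
    also have "\<dots> \<in> ?N"
      using X by (simp add: pm.span_base)
    finally have "(\<Sum>Y\<in>B. scal (if Y = X then 1 else 0) (v Y)) \<in> ?N" .
    from indep[OF this] X show False by auto
  qed
  have "pm.independent (A \<union> v ` B)"
  proof -
    have "u z = 0" if sum0: "(\<Sum>z\<in>A \<union> v ` B. scal (u z) z) = 0" and z: "z \<in> A \<union> v ` B" for u z
    proof -
      have eq: "(\<Sum>z\<in>A. scal (u z) z) + (\<Sum>X\<in>B. scal (u (v X)) (v X)) = 0"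
        using sum0 disj' fin finB by (simp add: sum.union_disjoint sum.reindex[OF inj])
      have "(\<Sum>X\<in>B. scal (u (v X)) (v X)) = - (\<Sum>z\<in>A. scal (u z) z)"
        using eq by (simp add: eq_neg_iff_add_eq_0 add.commute)
      also have "\<dots> \<in> ?N"
        by (intro pm.span_neg pm.span_sum pm.span_scale pm.span_base)
      finally have *: "\<forall>X\<in>B. u (v X) = 0" by (rule indep)
      then have "(\<Sum>z\<in>A. scal (u z) z) = 0" using eq by simp
      moreover have "pm.independent A"
        using ind by (rule pm.independent_mono) simp
      ultimately have "\<forall>z\<in>A. u z = 0"
        using fin(1) pm.dependent_finite by metis
      with * z show ?thesis by auto
    qed
    moreover have finU: "finite (A \<union> v ` B)" using fin finB by simp
    ultimately show ?thesis unfolding pm.dependent_finite[OF finU] by blast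
  qed
  moreover have "A \<union> v ` B \<subseteq> ?V"
    using v by (auto intro: pm.span_base)
  moreover have "?V \<subseteq> pm.span (A \<union> v ` B)"
  proof
    fix y assume "y \<in> ?V"
    then obtain c where c: "y - (\<Sum>X\<in>B. scal (c X) (v X)) \<in> ?N" using gen by blast
    have "?N \<subseteq> pm.span (A \<union> v ` B)" by (intro pm.span_mono) simp
    moreover have "(\<Sum>X\<in>B. scal (c X) (v X)) \<in> pm.span (A \<union> v ` B)"
      by (intro pm.span_sum pm.span_scale pm.span_base) auto
    ultimately show "y \<in> pm.span (A \<union> v ` B)"
      using c pm.span_add[of "y - (\<Sum>X\<in>B. scal (c X) (v X))" _ "\<Sum>X\<in>B. scal (c X) (v X)"]
      by auto
  qed
  ultimately have "card (A \<union> v ` B) = pm.dim ?V"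
    by (intro pm.basis_card_eq_dim)
  also have "\<dots> = card (A \<union> C)"
    using ind by (rule pm.dim_span_eq_card_independent)
  finally show ?thesis
    using fin finB disj disj' by (simp add: card_Un_disjoint card_image[OF inj])
qed

text \<open>The cosets of the elements of \<open>C\<close> form a basis.\<close>

lemma quot_basis_exists:
  assumes fin: "finite A" "finite C" and disj: "A \<inter> C = {}" and ind: "pm.independent (A \<union> C)"
  shows "\<exists>B. quot_basis (pm.span (A \<union> C)) (pm.span A) B"
proof -
  let ?V = "pm.span (A \<union> C)" and ?N = "pm.span A"
  let ?cos = "\<lambda>v. v +o ?N"
  have N: "pm.subspace ?N" by (rule pm.subspace_span)
  have coeff: "\<forall>z\<in>C. c z = 0" if c: "(\<Sum>z\<in>C. scal (c z) z) \<in> ?N" for c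
  proof -
    obtain u where u: "(\<Sum>z\<in>C. scal (c z) z) = (\<Sum>z\<in>A. scal (u z) z)"
      using c unfolding pm.span_finite[OF fin(1)] by auto
    \<comment> \<open>A relation among \<open>C\<close> modulo the span of \<open>A\<close> is a
      relation on \<open>A \<union> C\<close>, with the \<open>A\<close>-coefficients moved across
      with a sign.\<close>
    define w where "w = (\<lambda>z. if z \<in> C then c z else - u z)"
    have "(\<Sum>z\<in>A \<union> C. scal (w z) z) = (\<Sum>z\<in>A. scal (w z) z) + (\<Sum>z\<in>C. scal (w z) z)"
      using fin disj by (simp add: sum.union_disjoint)
    also have "(\<Sum>z\<in>A. scal (w z) z) = (\<Sum>z\<in>A. - scal (u z) z)"
      using disj by (intro sum.cong) (auto simp: w_def)
    also have "(\<Sum>z\<in>C. scal (w z) z) = (\<Sum>z\<in>C. scal (c z) z)"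
      by (intro sum.cong) (auto simp: w_def)
    finally have "(\<Sum>z\<in>A \<union> C. scal (w z) z) = 0"
      using u by (simp add: sum_negf)
    moreover have "finite (A \<union> C)" using fin by simp
    ultimately have "\<forall>z\<in>A \<union> C. w z = 0"
      using ind pm.dependent_finite by blast
    then show ?thesis by (auto simp: w_def split: if_splits)
  qed
  have inj: "inj_on ?cos C"
  proof (rule inj_onI, rule ccontr)
    fix x y assume xy: "x \<in> C" "y \<in> C" "?cos x = ?cos y" "x \<noteq> y"
    \<comment> \<open>Coefficients representing \<open>x - y\<close>, which lies in
      \<open>?N\<close> when the two cosets agree.\<close>
    let ?c = "\<lambda>z. (if z = x then 1 else 0) - (if z = y then 1 else 0) :: complex"
    have "(\<Sum>z\<in>C. scal (?c z) z) = (\<Sum>z\<in>C. (if z = x then z else 0) - (if z = y then z else 0))"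
      by (intro sum.cong) auto
    also have "\<dots> = x - y"
      using xy fin by (simp add: sum_subtractf)
    also have "\<dots> \<in> ?N"
      using xy coset_eq_iff[OF N] by blast
    finally have "(\<Sum>z\<in>C. scal (?c z) z) \<in> ?N" .
    from coeff[OF this] xy show False by auto
  qed
  define v where "v = inv_into C ?cos"
  have vC: "v (?cos z) = z" if "z \<in> C" for z
    unfolding v_def using inv_into_f_f[OF inj that] .
  have v: "v X \<in> ?V \<and> v X +o ?N = X" if "X \<in> ?cos ` C" for X
    using that vC by (auto intro: pm.span_base)
  have sums: "(\<Sum>X\<in>?cos ` C. scal (c X) (v X)) = (\<Sum>z\<in>C. scal (c (?cos z)) z)" for c
    by (simp add: sum.reindex[OF inj] vC)
  have "quot_basis ?V ?N (?cos ` C)"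
  proof (subst quot_basis_iff[OF N _ v])
    have "\<exists>c. y - (\<Sum>X\<in>?cos ` C. scal (c X) (v X)) \<in> ?N" if y: "y \<in> ?V" for y
    proof -
      obtain u where u: "y = (\<Sum>z\<in>A \<union> C. scal (u z) z)"
        using y fin pm.span_finite[of "A \<union> C"] by auto
      have "y - (\<Sum>X\<in>?cos ` C. scal (u (v X)) (v X)) = (\<Sum>z\<in>A. scal (u z) z)"
        unfolding sums u using fin disj by (simp add: vC sum.union_disjoint)
      also have "\<dots> \<in> ?N"
        by (intro pm.span_sum pm.span_scale pm.span_base)
      finally show ?thesis by (intro exI)
    qed
    then show "(\<forall>c. (\<Sum>X\<in>?cos ` C. scal (c X) (v X)) \<in> ?N \<longrightarrow> (\<forall>X\<in>?cos ` C. c X = 0)) \<and>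
      (\<forall>y\<in>?V. \<exists>c. y - (\<Sum>X\<in>?cos ` C. scal (c X) (v X)) \<in> ?N)"
      unfolding sums using coeff by fastforce
  qed (use fin in auto)
  then show ?thesis by blast
qed

lemma quot_dim_span_Un:
  assumes "finite A" "finite C" "A \<inter> C = {}" "pm.independent (A \<union> C)"
  shows "quot_dim (pm.span (A \<union> C)) (pm.span A) = card C"
  using quot_basis_exists[OF assms] quot_basis_card[OF assms]
  unfolding quot_dim_def by (simp add: someI_ex)

text \<open>Up to a nonzero factor, \<open>\<phi> i\<close> reads off the coefficient of
  \<open>G i\<close>; hence the \<open>G i\<close> are independent. For \<open>i\<close> in
  \<open>C\<close> this coefficient vanishes on \<open>S\<close>, so \<open>S\<close> meets the span
  exactly in the span of the remaining \<open>G i\<close>.\<close>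

lemma quot_dim_biorthogonal:
  fixes G :: "'i \<Rightarrow> ('m \<Rightarrow>\<^sub>0 complex)" and \<phi> :: "'i \<Rightarrow> ('m \<Rightarrow>\<^sub>0 complex) \<Rightarrow> complex"
  assumes fin: "finite J" and C: "C \<subseteq> J"
    and lin: "\<And>i. i \<in> J \<Longrightarrow> Vector_Spaces.linear scal (*) (\<phi> i)"
    and diag: "\<And>i. i \<in> J \<Longrightarrow> \<phi> i (G i) \<noteq> 0"
    and off: "\<And>i j. i \<in> J \<Longrightarrow> j \<in> J \<Longrightarrow> i \<noteq> j \<Longrightarrow> \<phi> i (G j) = 0"
    and S: "pm.subspace S" "\<And>i. i \<in> J - C \<Longrightarrow> G i \<in> S"
    and kill: "\<And>i s. i \<in> C \<Longrightarrow> s \<in> S \<Longrightarrow> \<phi> i s = 0"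
  shows "quot_dim (pm.span (G ` J)) (S \<inter> pm.span (G ` J)) = card (G ` C)"
proof -
  have inj: "inj_on G J"
    by (metis diag inj_onI off)
  have eval: "\<phi> i (\<Sum>j\<in>J. scal (c j) (G j)) = c i * \<phi> i (G i)" if i: "i \<in> J" for i c
  proof -
    interpret p: Vector_Spaces.linear scal "(*)" "\<phi> i" by (rule lin[OF i])
    have "\<phi> i (\<Sum>j\<in>J. scal (c j) (G j)) = (\<Sum>j\<in>J. c j * \<phi> i (G j))"
      by (simp add: p.sum p.scale)
    also have "\<dots> = (\<Sum>j\<in>J. if j = i then c i * \<phi> i (G i) else 0)"
      using off i by (intro sum.cong) auto
    finally show ?thesis using fin i by simp
  qed
  have phi0: "\<phi> i 0 = 0" if i: "i \<in> J" for i
  proof -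
    interpret p: Vector_Spaces.linear scal "(*)" "\<phi> i" by (rule lin[OF i])
    show ?thesis by (rule p.zero)
  qed
  have ind: "pm.independent (G ` J)"
  proof -
    have "u z = 0" if sum0: "(\<Sum>z\<in>G ` J. scal (u z) z) = 0" and z: "z \<in> G ` J" for u z
    proof -
      obtain i where i: "i \<in> J" "z = G i" using z by auto
      have "(\<Sum>j\<in>J. scal (u (G j)) (G j)) = 0"
        using sum0 by (simp add: sum.reindex[OF inj])
      with eval[OF i(1), of "\<lambda>j. u (G j)"] phi0[OF i(1)] diag[OF i(1)] show ?thesis
        by (simp add: i)
    qed
    then show ?thesis using fin by (subst pm.dependent_finite) auto
  qed
  have JC: "G ` J = G ` (J - C) \<union> G ` C" using C by auto
  have "S \<inter> pm.span (G ` J) = pm.span (G ` (J - C))"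
  proof (intro subset_antisym subsetI)
    fix s assume s: "s \<in> S \<inter> pm.span (G ` J)"
    then obtain u where u: "s = (\<Sum>z\<in>G ` J. scal (u z) z)"
      using fin pm.span_finite[of "G ` J"] by auto
    then have u': "s = (\<Sum>j\<in>J. scal (u (G j)) (G j))"
      by (simp add: sum.reindex[OF inj])
    have "u (G i) = 0" if "i \<in> C" for i
      using eval[of i "\<lambda>j. u (G j)"] kill[OF that, of s] s diag[of i] C that
      by (auto simp flip: u')
    then have "s = (\<Sum>j\<in>J - C. scal (u (G j)) (G j))"
      unfolding u' using fin by (intro sum.mono_neutral_right) auto
    then show "s \<in> pm.span (G ` (J - C))"
      by (simp only:) (intro pm.span_sum pm.span_scale pm.span_base imageI)
  next
    fix s assume s: "s \<in> pm.span (G ` (J - C))"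
    have "pm.span (G ` (J - C)) \<subseteq> S"
      using S by (intro pm.span_minimal) auto
    moreover have "pm.span (G ` (J - C)) \<subseteq> pm.span (G ` J)"
      by (intro pm.span_mono) auto
    ultimately show "s \<in> S \<inter> pm.span (G ` J)" using s by blast
  qed
  moreover have "G ` (J - C) \<inter> G ` C = {}"
    using inj C by (auto dest: inj_onD)
  ultimately show ?thesis
    using quot_dim_span_Un[of "G ` (J - C)" "G ` C"] fin C ind finite_subset[OF C fin]
    by (simp flip: JC)
qed

section \<open>Coefficients of derivatives, tensors and polarizations\<close>

text \<open>The truncated exponent \<open>a - 1\<close> in \<open>dx_def\<close> is harmless: for
  \<open>a = 0\<close> the term has coefficient 0.\<close>

lemma lookup_dx: "Poly_Mapping.lookup (dx f) (a, b) = of_nat (Suc a) * Poly_Mapping.lookup f (Suc a, b)"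
proof -
  have "Poly_Mapping.lookup (dx f) (a, b) =
      (\<Sum>m\<in>Poly_Mapping.keys f. if m = (Suc a, b) then of_nat (Suc a) * Poly_Mapping.lookup f (Suc a, b) else 0)"
    unfolding dx_def lookup_sum
    by (intro sum.cong) (auto simp: lookup_single when_def split: prod.splits)
  then show ?thesis by (simp add: in_keys_iff)
qed

lemma lookup_dy: "Poly_Mapping.lookup (dy f) (a, b) = of_nat (Suc b) * Poly_Mapping.lookup f (a, Suc b)"
proof -
  have "Poly_Mapping.lookup (dy f) (a, b) =
      (\<Sum>m\<in>Poly_Mapping.keys f. if m = (a, Suc b) then of_nat (Suc b) * Poly_Mapping.lookup f (a, Suc b) else 0)"
    unfolding dy_def lookup_sum
    by (intro sum.cong) (auto simp: lookup_single when_def split: prod.splits)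
  then show ?thesis by (simp add: in_keys_iff)
qed

lemma lookup_dx_funpow:
  "Poly_Mapping.lookup ((dx ^^ n) f) (a, b) = fact (a + n) / fact a * Poly_Mapping.lookup f (a + n, b)"
proof (induction n arbitrary: a)
  case (Suc n)
  have "Poly_Mapping.lookup ((dx ^^ Suc n) f) (a, b) =
      of_nat (Suc a) * (fact (Suc a + n) / fact (Suc a) * Poly_Mapping.lookup f (Suc a + n, b))"
    by (simp add: lookup_dx Suc.IH del: of_nat_Suc)
  also have "\<dots> = fact (a + Suc n) / fact a * Poly_Mapping.lookup f (a + Suc n, b)"
    by (simp add: fact_Suc[of a] del: of_nat_Suc fact_Suc)
  finally show ?case .
qed simp

lemma lookup_dy_funpow:
  "Poly_Mapping.lookup ((dy ^^ n) f) (a, b) = fact (b + n) / fact b * Poly_Mapping.lookup f (a, b + n)"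
proof (induction n arbitrary: b)
  case (Suc n)
  have "Poly_Mapping.lookup ((dy ^^ Suc n) f) (a, b) =
      of_nat (Suc b) * (fact (Suc b + n) / fact (Suc b) * Poly_Mapping.lookup f (a, Suc b + n))"
    by (simp add: lookup_dy Suc.IH del: of_nat_Suc)
  also have "\<dots> = fact (b + Suc n) / fact b * Poly_Mapping.lookup f (a, b + Suc n)"
    by (simp add: fact_Suc[of b] del: of_nat_Suc fact_Suc)
  finally show ?case .
qed simp

lemma lookup_tensor:
  "Poly_Mapping.lookup (tensor f g) (m, n) = Poly_Mapping.lookup f m * Poly_Mapping.lookup g n"
proof -
  have "Poly_Mapping.lookup (tensor f g) (m, n) =
     (\<Sum>m'\<in>Poly_Mapping.keys f. \<Sum>n'\<in>Poly_Mapping.keys g.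
       if n' = n then if m' = m then Poly_Mapping.lookup f m * Poly_Mapping.lookup g n else 0 else 0)"
    unfolding tensor_def lookup_sum
    by (intro sum.cong) (auto simp: lookup_single when_def)
  also have "\<dots> = Poly_Mapping.lookup f m * Poly_Mapping.lookup g n"
    by (cases "Poly_Mapping.lookup g n = 0") (simp_all add: in_keys_iff)
  finally show ?thesis .
qed

lemma lookup_monom_xy: "Poly_Mapping.lookup (monom_xy a b) m = (if m = (a, b) then 1 else 0)"
  by (auto simp: monom_xy_def lookup_single when_def)

lemma lookup_tensor_map_dx_dy:
  "Poly_Mapping.lookup (tensor_map dx dy t) ((a, b), (c, e)) =
    of_nat (Suc a) * of_nat (Suc e) * Poly_Mapping.lookup t ((Suc a, b), (c, Suc e))"
proof -
  have "Poly_Mapping.lookup (tensor_map dx dy t) ((a, b), (c, e)) =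
     (\<Sum>p\<in>Poly_Mapping.keys t. if p = ((Suc a, b), (c, Suc e))
       then of_nat (Suc a) * of_nat (Suc e) * Poly_Mapping.lookup t ((Suc a, b), (c, Suc e)) else 0)"
    unfolding tensor_map_def lookup_sum
    by (intro sum.cong)
      (auto simp: lookup_scal lookup_tensor lookup_dx lookup_dy lookup_single when_def
        simp del: of_nat_Suc split: prod.splits)
  then show ?thesis by (simp add: in_keys_iff)
qed

lemma lookup_tensor_map_dy_dx:
  "Poly_Mapping.lookup (tensor_map dy dx t) ((a, b), (c, e)) =
    of_nat (Suc b) * of_nat (Suc c) * Poly_Mapping.lookup t ((a, Suc b), (Suc c, e))"
proof -
  have "Poly_Mapping.lookup (tensor_map dy dx t) ((a, b), (c, e)) =
     (\<Sum>p\<in>Poly_Mapping.keys t. if p = ((a, Suc b), (Suc c, e))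
       then of_nat (Suc b) * of_nat (Suc c) * Poly_Mapping.lookup t ((a, Suc b), (Suc c, e)) else 0)"
    unfolding tensor_map_def lookup_sum
    by (intro sum.cong)
      (auto simp: lookup_scal lookup_tensor lookup_dx lookup_dy lookup_single when_def
        simp del: of_nat_Suc split: prod.splits)
  then show ?thesis by (simp add: in_keys_iff)
qed

text \<open>The factorials turn \<^const>\<open>D_map\<close> into a difference operator and make polarizations constant.\<close>

definition apolar :: "btensor \<Rightarrow> (nat \<times> nat) \<times> (nat \<times> nat) \<Rightarrow> complex"
  where "apolar t = (\<lambda>((a, b), (c, e)).
    fact a * fact b * fact c * fact e * Poly_Mapping.lookup t ((a, b), (c, e)))"

lemma apolar_add: "apolar (s + t) m = apolar s m + apolar t m"
  by (auto simp: apolar_def lookup_add algebra_simps split: prod.splits)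

lemma apolar_scal: "apolar (scal c t) m = c * apolar t m"
  by (auto simp: apolar_def lookup_scal split: prod.splits)

lemma apolar_zero [simp]: "apolar 0 m = 0"
  by (auto simp: apolar_def split: prod.splits)

lemma apolar_sum: "apolar (\<Sum>i\<in>I. f i) m = (\<Sum>i\<in>I. apolar (f i) m)"
  by (induction I rule: infinite_finite_induct) (auto simp: apolar_add)

lemma apolar_eqI:
  assumes "\<And>a b c e. apolar s ((a, b), (c, e)) = apolar t ((a, b), (c, e))"
  shows "s = t"
  by (rule poly_mapping_eqI) (use assms in \<open>auto simp: apolar_def\<close>)

lemma apolar_tensor_monom:
  "apolar (tensor (monom_xy u v) (monom_xy u' v')) ((a, b), (c, e)) =
    (if a = u \<and> b = v \<and> c = u' \<and> e = v' then fact u * fact v * fact u' * fact v' else 0)"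
  by (simp add: apolar_def lookup_tensor lookup_monom_xy)

text \<open>Each derivative multiplies by the exponent it lowers, and the factorial weight absorbs
  this factor. Both terms have the same total degree in x and in y.\<close>

lemma apolar_D_map:
  "apolar (D_map t) ((a, b), (c, e)) =
    apolar t ((Suc a, b), (c, Suc e)) - apolar t ((a, Suc b), (Suc c, e))"
  by (simp add: apolar_def D_map_def lookup_minus lookup_tensor_map_dx_dy lookup_tensor_map_dy_dx
    algebra_simps)

text \<open>Only the summand \<open>i = b\<close> contributes. The weights cancel the binomial and
  the factorials left by differentiation, so the value depends on the key only through the total
  exponents \<open>a + c\<close> and \<open>b + e\<close>.\<close>

lemma apolar_polar:
  "apolar (polar n k g) ((a, b), (c, e)) =
    (if a + b = k then fact (n - k) * fact k / fact n * (fact (a + c) * fact (b + e)) *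
       Poly_Mapping.lookup g (a + c, b + e) else 0)"
proof -
  have "Poly_Mapping.lookup (polar n k g) ((a, b), (c, e)) = fact (n - k) / fact n *
      (\<Sum>i = 0..k. if i = b then if a + b = k then of_nat (k choose b) *
        (fact (a + c) / fact c * (fact (b + e) / fact e * Poly_Mapping.lookup g (a + c, b + e)))
        else 0 else 0)"
    unfolding polar_def lookup_scal lookup_sum
    by (intro arg_cong2[where f = "(*)"] sum.cong refl)
      (auto simp: lookup_tensor lookup_monom_xy lookup_dx_funpow lookup_dy_funpow add.commute)
  also have "\<dots> = (if a + b = k then fact (n - k) / fact n * (of_nat (k choose b) *
        (fact (a + c) / fact c * (fact (b + e) / fact e * Poly_Mapping.lookup g (a + c, b + e))))
        else 0)"
    by (auto simp: sum.delta)
  also have "of_nat (k choose b) = (fact k / (fact b * fact (k - b)) :: complex)" if "a + b = k"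
    using that binomial_fact[of b k] by simp
  ultimately show ?thesis
    by (auto simp: apolar_def field_simps)
qed

section \<open>Linearity of the operators and spanning sets of iterated derivatives\<close>

lemma linear_dx: "Vector_Spaces.linear scal scal dx"
  by unfold_locales (auto intro!: poly_mapping_eqI simp: lookup_dx lookup_add lookup_scal algebra_simps)

lemma linear_dy: "Vector_Spaces.linear scal scal dy"
  by unfold_locales (auto intro!: poly_mapping_eqI simp: lookup_dy lookup_add lookup_scal algebra_simps)

lemma linear_D_map: "Vector_Spaces.linear scal scal D_map"
  by unfold_locales (auto intro!: apolar_eqI simp: apolar_D_map apolar_add apolar_scal algebra_simps)

lemma linear_polar: "Vector_Spaces.linear scal scal (polar n k)"
  by unfold_locales (auto intro!: apolar_eqI
    simp: apolar_polar apolar_add apolar_scal lookup_add lookup_scal algebra_simps add_divide_distrib)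

lemma dx_dy_commute: "dx (dy f) = dy (dx f)"
  by (rule poly_mapping_eqI) (auto simp: lookup_dx lookup_dy)

lemma dy_dx_funpow: "dy ((dx ^^ n) f) = (dx ^^ n) (dy f)"
  by (induction n) (simp_all flip: dx_dy_commute)

lemma partial_span: "partial (pm.span S) = pm.span (dx ` S \<union> dy ` S)"
proof -
  interpret x: Vector_Spaces.linear scal scal dx by (rule linear_dx)
  interpret y: Vector_Spaces.linear scal scal dy by (rule linear_dy)
  show ?thesis
    unfolding partial_def by (simp add: pm.span_Un x.span_image y.span_image pm.span_span)
qed

text \<open>As \<open>dx\<close> and \<open>dy\<close> commute, in the induction step
  \<open>dx\<close> shifts the index \<open>j\<close> by one and \<open>dy\<close> keeps it;
  together these indices fill \<open>{0..Suc n}\<close>.\<close>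

lemma partial_pow_eq_span:
  "partial_pow n g = pm.span ((\<lambda>j. (dx ^^ j) ((dy ^^ (n - j)) g)) ` {0..n})"
proof (induction n)
  case 0
  show ?case by (simp add: partial_pow_def)
next
  case (Suc n)
  have "dx ` (\<lambda>j. (dx ^^ j) ((dy ^^ (n - j)) g)) ` {0..n} =
      (\<lambda>j. (dx ^^ j) ((dy ^^ (Suc n - j)) g)) ` Suc ` {0..n}"
    unfolding image_image by simp
  moreover have "dy ` (\<lambda>j. (dx ^^ j) ((dy ^^ (n - j)) g)) ` {0..n} =
      (\<lambda>j. (dx ^^ j) ((dy ^^ (Suc n - j)) g)) ` {0..n}"
    unfolding image_image by (intro image_cong) (simp_all add: dy_dx_funpow Suc_diff_le)
  moreover have "Suc ` {0..n} \<union> {0..n} = {0..Suc n}"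
    by (auto simp: image_Suc_atLeastAtMost)
  ultimately have "dx ` (\<lambda>j. (dx ^^ j) ((dy ^^ (n - j)) g)) ` {0..n} \<union>
      dy ` (\<lambda>j. (dx ^^ j) ((dy ^^ (n - j)) g)) ` {0..n} =
      (\<lambda>j. (dx ^^ j) ((dy ^^ (Suc n - j)) g)) ` {0..Suc n}"
    by (simp flip: image_Un)
  moreover have "partial_pow (Suc n) g = partial (partial_pow n g)"
    by (simp add: partial_pow_def)
  ultimately show ?case
    by (simp add: Suc.IH partial_span)
qed

lemma polar_space_eq_span:
  "polar_space d l h k = pm.span (generator d l h k ` {0..l - k})"
proof -
  interpret p: Vector_Spaces.linear scal scal "polar (d + k - 2) (k - 1)" by (rule linear_polar)
  show ?thesis
    unfolding polar_space_def partial_pow_eq_span generator_def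
    by (simp only: p.span_image[symmetric] image_image)
qed

section \<open>Monomial spaces with gaps\<close>

text \<open>
  Exponents of \<open>y\<close> are shifted by \<open>a = \<alpha>\<^sub>1 - 1\<close>, so that they lie in \<open>{0..l}\<close> and the exponents missing
  from \<open>T\<close> are the partial sums \<open>P i = \<gamma>\<^sub>1 + \<dots> + \<gamma>\<^sub>i\<close>, i.e. the borders of the blocks.
\<close>

locale gapped_monomials =
  fixes d l r a :: nat and P :: "nat \<Rightarrow> nat" and T :: "bpoly set"
  assumes mono_P: "mono P" and P_0: "P 0 = 0" and P_r: "P r = l"
    and a_pos: "0 < a" and a_l: "a + l < d"
    and monom_in_T: "\<And>m. m \<le> l \<Longrightarrow> m \<notin> P ` {0..r} \<Longrightarrow> monom_xy (d - (a + m)) (a + m) \<in> T"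
    and lookup_T_gap: "\<And>f i c. f \<in> T \<Longrightarrow> i \<le> r \<Longrightarrow> Poly_Mapping.lookup f (c, a + P i) = 0"
begin

text \<open>The apex in shifted exponents, where \<alpha>_1 = a + 1 and \<beta>_r = a + l -
  1.\<close>

definition apex_form :: bpoly
  where "apex_form = monom_xy (d - Suc a) (a + l - 1)"

text \<open>The common value of all generators on their supports: the normalization of the
  polarization times the factorials of the apex exponents.\<close>

definition gen_const :: "nat \<Rightarrow> complex"
  where "gen_const k = fact (d - 1) * fact (k - 1) / fact (d + k - 2) * (fact (d - Suc a) * fact (a + l - 1))"

lemma gen_const_nonzero: "gen_const k \<noteq> 0"
  by (simp add: gen_const_def)

lemma apolar_generator:
  assumes "2 \<le> k" "j + k \<le> l"
  shows "apolar (generator d l apex_form k j) ((x, b), (c, e)) =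
    (if x + b = k - 1 \<and> x + c = d - Suc a - j \<and> b + e = a + k + j - 1 then gen_const k else 0)"
proof -
  have "d + k - 2 - (k - 1) = d - 1"
    using assms a_l by linarith
  moreover have "x + c + j = d - Suc a \<longleftrightarrow> x + c = d - Suc a - j"
    using assms a_l a_pos by linarith
  moreover have "b + e + (l - k - j) = a + l - 1 \<longleftrightarrow> b + e = a + k + j - 1"
    using assms a_pos by linarith
  ultimately show ?thesis
    unfolding generator_def apolar_polar gen_const_def apex_form_def
    by (auto simp: lookup_dx_funpow lookup_dy_funpow lookup_monom_xy)
qed

text \<open>Vanishing of a coordinate is a linear condition, so pure tensors suffice.\<close>

lemma lookup_tensor_space_gap:
  assumes t: "t \<in> tensor_space V T" and i: "i \<le> r"
  shows "Poly_Mapping.lookup t (m, (c, a + P i)) = 0"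
proof -
  let ?S = "{t :: btensor. Poly_Mapping.lookup t (m, (c, a + P i)) = 0}"
  have "pm.subspace ?S"
    by (auto simp: pm.subspace_def lookup_add lookup_scal)
  then have "tensor_space V T \<subseteq> ?S"
    unfolding tensor_space_def
    by (intro pm.span_minimal) (auto simp: lookup_tensor lookup_T_gap[OF _ i])
  then show ?thesis using t by auto
qed

text \<open>A linear function vanishing at the only border within reach has constant difference and
  is supported on the monomials of \<open>T\<close>. If no border is within reach,
  \<open>m\<^sub>0\<close> is arbitrary.\<close>

lemma generator_in_image:
  assumes k: "2 \<le> k" "j + k \<le> l"
    and unique: "\<And>i. i \<le> r \<Longrightarrow> j \<le> P i \<Longrightarrow> P i \<le> j + k \<Longrightarrow> P i = m\<^sub>0"
  shows "generator d l apex_form k j \<in> D_map ` tensor_space (Sym k) T"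
proof -
  \<comment> \<open>The total y-degree of the preimage, one more than that of the generator.\<close>
  define w where "w = a + k + j"
  \<comment> \<open>With \<open>m = k + j - b\<close>, so that the second factor has y-degree
    \<open>a + m\<close>, this is \<open>gen_const k\<close> times
    \<open>m - m\<^sub>0\<close>.\<close>
  define u :: "nat \<Rightarrow> complex" where "u b = gen_const k * (of_nat (k + j) - of_nat b - of_nat m\<^sub>0)" for b
  \<comment> \<open>Dividing by the factorials makes \<open>u\<close> the weighted coordinates of
    \<open>t\<close>.\<close>
  define t where "t = (\<Sum>b = 0..k. scal (u b / (fact (k - b) * fact b * fact (d - (w - b)) * fact (w - b)))
    (tensor (monom_xy (k - b) b) (monom_xy (d - (w - b)) (w - b))))"
  have wd: "w < d" using k a_l by (simp add: w_def)
  have apolar_t: "apolar t ((x, b), (c, e)) = (if x + b = k \<and> c + e = d \<and> b + e = w then u b else 0)"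
    for x b c e
  proof -
    have "apolar t ((x, b), (c, e)) =
        (\<Sum>b'=0..k. if b' = b then if x + b = k \<and> c + e = d \<and> b + e = w then u b else 0 else 0)"
      unfolding t_def apolar_sum
    proof (intro sum.cong refl)
      fix b' assume b': "b' \<in> {0..k}"
      have "(x = k - b' \<and> b = b' \<and> c = d - (w - b') \<and> e = w - b') \<longleftrightarrow>
          (b' = b \<and> x + b = k \<and> c + e = d \<and> b + e = w)"
        using b' wd k by (auto simp: w_def)
      then show "apolar (scal (u b' / (fact (k - b') * fact b' * fact (d - (w - b')) * fact (w - b')))
            (tensor (monom_xy (k - b') b') (monom_xy (d - (w - b')) (w - b')))) ((x, b), (c, e)) =
          (if b' = b then if x + b = k \<and> c + e = d \<and> b + e = w then u b else 0 else 0)"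
        unfolding apolar_scal apolar_tensor_monom by auto
    qed
    then show ?thesis by auto
  qed
  have "t \<in> tensor_space (Sym k) T"
    unfolding t_def tensor_space_def
  proof (intro pm.span_sum)
    fix b assume b: "b \<in> {0..k}"
    define m where "m = k + j - b"
    have m: "j \<le> m" "m \<le> j + k" "m \<le> l" "w - b = a + m"
      using b k by (auto simp: m_def w_def)
    show "scal (u b / (fact (k - b) * fact b * fact (d - (w - b)) * fact (w - b)))
        (tensor (monom_xy (k - b) b) (monom_xy (d - (w - b)) (w - b)))
      \<in> pm.span {tensor f g |f g. f \<in> Sym k \<and> g \<in> T}"
    \<comment> \<open>At a border the monomial need not lie in \<open>T\<close>, but there
      \<open>u\<close> is zero.\<close>
    proof (cases "m \<in> P ` {0..r}")
      case True
      then have "m = m\<^sub>0" using unique m by auto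
      then have "u b = 0"
        using b by (auto simp: u_def m_def of_nat_diff)
      then show ?thesis by (simp add: pm.span_zero)
    next
      case False
      have "monom_xy (k - b) b \<in> Sym k"
        using b by (auto simp: Sym_def monom_xy_def)
      with monom_in_T[OF m(3) False] show ?thesis
        unfolding m(4) by (intro pm.span_scale pm.span_base) blast
    qed
  qed
  moreover have "D_map t = generator d l apex_form k j"
  proof (rule apolar_eqI)
    fix x b c e
    have "(x + b = k - 1 \<and> x + c = d - Suc a - j \<and> b + e = a + k + j - 1) \<longleftrightarrow>
        (Suc x + b = k \<and> c + Suc e = d \<and> b + Suc e = w)"
      using k a_l a_pos unfolding w_def by linarith
    \<comment> \<open>The two terms of the difference are both on the line or both off it, so no
      boundary terms arise.\<close>
    moreover have "(Suc x + b = k \<and> c + Suc e = d \<and> b + Suc e = w) \<longleftrightarrow>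
        (x + Suc b = k \<and> Suc c + e = d \<and> Suc b + e = w)"
      by auto
    moreover have "u b - u (Suc b) = gen_const k"
      by (simp add: u_def algebra_simps)
    ultimately show "apolar (D_map t) ((x, b), (c, e)) = apolar (generator d l apex_form k j) ((x, b), (c, e))"
      unfolding apolar_D_map apolar_t apolar_generator[OF k] by (simp del: add_Suc add_Suc_right)
  qed
  ultimately show ?thesis by (metis imageI)
qed

text \<open>
  The monomial with second factor of \<open>y\<close>-degree \<open>a + m\<close> that occurs in the \<open>j\<close>-th generator,
  for \<open>j \<le> m < j + k\<close>.
\<close>

definition window_key :: "nat \<Rightarrow> nat \<Rightarrow> nat \<Rightarrow> (nat \<times> nat) \<times> (nat \<times> nat)"
  where "window_key k j m = ((m - j, j + k - 1 - m), (d - Suc a - m, a + m))"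

text \<open>The total x-degree of the key is \<open>d - Suc a - j\<close>, which determines the
  generator: distinct generators have disjoint supports.\<close>

lemma apolar_generator_window_key:
  assumes "2 \<le> k" "j + k \<le> l" "j' + k \<le> l" "m \<in> {j..<j + k}"
  shows "apolar (generator d l apex_form k j') (window_key k j m) = (if j' = j then gen_const k else 0)"
proof -
  have "(m - j + (j + k - 1 - m) = k - 1 \<and> m - j + (d - Suc a - m) = d - Suc a - j' \<and>
      j + k - 1 - m + (a + m) = a + k + j' - 1) \<longleftrightarrow> j' = j"
    using assms a_l by auto
  then show ?thesis
    unfolding window_key_def apolar_generator[OF assms(1,3)] by simp
qed

text \<open>The sum telescopes to the values of \<open>t\<close> at the two borders of the block,
  and both are exponents missing from \<open>T\<close>.\<close>

lemma sum_apolar_D_map_block: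
  assumes t: "t \<in> tensor_space V T" and i: "i < r" and j: "j \<le> P i" "P (Suc i) \<le> j + k" "j + k \<le> l"
  shows "(\<Sum>m = P i..<P (Suc i). apolar (D_map t) (window_key k j m)) = 0"
proof -
  let ?F = "\<lambda>m. apolar t ((m - j, j + k - m), (d - a - m, a + m))"
  have "(\<Sum>m = P i..<P (Suc i). apolar (D_map t) (window_key k j m)) =
      (\<Sum>m = P i..<P (Suc i). ?F (Suc m) - ?F m)"
  proof (intro sum.cong refl)
    fix m assume "m \<in> {P i..<P (Suc i)}"
    \<comment> \<open>Since the block lies in the window, none of these subtractions is
      truncated.\<close>
    then have "Suc (m - j) = Suc m - j" "Suc (j + k - 1 - m) = j + k - m"
      "Suc (d - Suc a - m) = d - a - m" "d - Suc a - m = d - a - Suc m" "j + k - 1 - m = j + k - Suc m"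
      using j a_l by auto
    then show "apolar (D_map t) (window_key k j m) = ?F (Suc m) - ?F m"
      unfolding window_key_def apolar_D_map by simp
  qed
  also have "\<dots> = ?F (P (Suc i)) - ?F (P i)"
    using mono_P by (intro sum_Suc_diff') (simp add: monoD)
  also have "\<dots> = 0"
    using i lookup_tensor_space_gap[OF t] by (simp add: apolar_def)
  finally show ?thesis .
qed

lemma quot_dim_eq_card_covering:
  assumes k: "2 \<le> k" "k \<le> l"
    and C: "C = {j \<in> {0..l - k}. \<exists>i<r. P i < P (Suc i) \<and> j \<le> P i \<and> P (Suc i) \<le> j + k}"
  shows "quot_dim (polar_space d l apex_form k) (D_map ` tensor_space (Sym k) T \<inter> polar_space d l apex_form k) =
    card (generator d l apex_form k ` C)"
proof -
  have "\<exists>i. i < r \<and> P i < P (Suc i) \<and> j \<le> P i \<and> P (Suc i) \<le> j + k" if "j \<in> C" for j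
    using that C by auto
  then obtain I where I: "\<And>j. j \<in> C \<Longrightarrow> I j < r \<and> P (I j) < P (Suc (I j)) \<and> j \<le> P (I j) \<and> P (Suc (I j)) \<le> j + k"
    by metis
  \<comment> \<open>For a covering index the functional sums over a block inside the window, so that
    it kills the image; for the others one coordinate suffices to separate the generators.\<close>
  define M where "M j = (if j \<in> C then {P (I j)..<P (Suc (I j))} else {j})" for j
  define \<phi> where "\<phi> j t = (\<Sum>m\<in>M j. apolar t (window_key k j m))" for j t
  have M: "finite (M j)" "M j \<noteq> {}" "M j \<subseteq> {j..<j + k}" for j
    using I[of j] k by (auto simp: M_def)
  have \<phi>_gen: "\<phi> j (generator d l apex_form k j') = (if j' = j then of_nat (card (M j)) * gen_const k else 0)"
    if "j \<in> {0..l - k}" "j' \<in> {0..l - k}" for j j'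
  proof -
    have "\<phi> j (generator d l apex_form k j') = (\<Sum>m\<in>M j. if j' = j then gen_const k else 0)"
      unfolding \<phi>_def using that k M(3)[of j]
      by (intro sum.cong refl apolar_generator_window_key)
        (auto dest: subsetD)
    then show ?thesis by simp
  qed
  interpret D: Vector_Spaces.linear scal scal D_map by (rule linear_D_map)
  show ?thesis
    unfolding polar_space_eq_span
  proof (rule quot_dim_biorthogonal[where \<phi> = \<phi>])
    fix j show "Vector_Spaces.linear scal (*) (\<phi> j)"
      unfolding \<phi>_def
      by unfold_locales
        (auto simp: apolar_add apolar_scal sum.distrib sum_distrib_left algebra_simps)
  next
    show "pm.subspace (D_map ` tensor_space (Sym k) T)"
      unfolding tensor_space_def by (intro D.subspace_image pm.subspace_span)
  next
    fix j assume j: "j \<in> {0..l - k} - C"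
    \<comment> \<open>Two distinct borders within reach would enclose a nonempty block and make
      \<open>j\<close> covering.\<close>
    have "\<exists>m\<^sub>0. \<forall>i\<le>r. j \<le> P i \<and> P i \<le> j + k \<longrightarrow> P i = m\<^sub>0"
    proof (rule ccontr)
      assume no: "\<nexists>m\<^sub>0. \<forall>i\<le>r. j \<le> P i \<and> P i \<le> j + k \<longrightarrow> P i = m\<^sub>0"
      then obtain i where i: "i \<le> r" "j \<le> P i" "P i \<le> j + k" by blast
      with no obtain i' where i': "i' \<le> r" "j \<le> P i'" "P i' \<le> j + k" "P i' \<noteq> P i" by blast
      obtain p p' where p: "p' \<le> r" "j \<le> P p" "P p' \<le> j + k" "P p < P p'"
        using i i' by (metis linorder_neqE_nat)
      \<comment> \<open>The block ending at \<open>P s\<close> starts at \<open>P p\<close>: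
        \<open>P\<close> is only monotone here, so the predecessor of \<open>s\<close> may differ
        from \<open>p\<close>, but \<open>P\<close> agrees on both.\<close>
      define s where "s = (LEAST s. P p < P s)"
      have s: "P p < P s" "s \<le> p'"
        unfolding s_def using p(4) by (auto intro: LeastI Least_le)
      have "s \<noteq> 0" using s(1) P_0 by (metis not_less_zero)
      then obtain s' where s': "s = Suc s'" by (cases s) auto
      have "P s' = P p"
      proof (rule antisym)
        show "P s' \<le> P p"
          using not_less_Least[of s' "\<lambda>s. P p < P s"] s' by (simp add: s_def not_less)
        have "p < s" using s(1) mono_P by (meson leD leI monoD)
        then show "P p \<le> P s'" using mono_P s' by (simp add: monoD)
      qed
      moreover have "P s \<le> j + k" using monoD[OF mono_P s(2)] p(3) by simp
      ultimately have "j \<in> C" using j s s' p unfolding C by auto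
      with j show False by simp
    qed
    then obtain m\<^sub>0 where "\<forall>i\<le>r. j \<le> P i \<and> P i \<le> j + k \<longrightarrow> P i = m\<^sub>0" by blast
    then show "generator d l apex_form k j \<in> D_map ` tensor_space (Sym k) T"
      using j k by (intro generator_in_image[of k j m\<^sub>0]) auto
  next
    fix j s assume "j \<in> C" "s \<in> D_map ` tensor_space (Sym k) T"
    moreover have "j + k \<le> l" using \<open>j \<in> C\<close> k by (auto simp: C)
    ultimately show "\<phi> j s = 0"
      using I[of j] unfolding \<phi>_def M_def by (auto intro!: sum_apolar_D_map_block)
  qed (use C M k \<phi>_gen gen_const_nonzero in auto)
qed

end

section \<open>Special spaces as gapped monomial spaces\<close>

theorem theorem4p1:
  fixes d r l k :: nat and \<gamma> :: "nat \<Rightarrow> nat" and T :: "bpoly set" and h :: bpoly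
  assumes "special_with d T l h r \<gamma>"
    and "k \<in> {2..l}"
  shows "q d T l h k = card (covering_generators d l h r \<gamma> k)"
proof -
  obtain \<alpha> \<beta> where sp: "special d r \<alpha> \<beta> T" and h: "h = apex d r \<alpha> \<beta>"
    and \<gamma>: "\<And>i. i \<in> {1..r} \<Longrightarrow> \<gamma> i = part \<alpha> \<beta> i" and l: "l = height r \<gamma>"
    using assms(1) unfolding special_with_def by blast
  have r: "2 \<le> r" and \<alpha>1: "2 \<le> \<alpha> 1" and \<beta>r: "\<beta> r \<le> d - 2"
    and \<alpha>\<beta>: "\<And>i. i \<in> {1..r} \<Longrightarrow> \<alpha> i \<le> \<beta> i"
    and next_\<alpha>: "\<And>i. i \<in> {1..<r} \<Longrightarrow> \<alpha> (i + 1) = \<beta> i + 2"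
    and T: "T = pm.span ((\<lambda>j. monom_xy (d - j) j) ` (\<Union>i\<in>{1..r}. {\<alpha> i..\<beta> i}))"
    using sp unfolding special_def by auto
  \<comment> \<open>The exponent just before the first interval becomes the border
    \<open>P 0 = 0\<close>.\<close>
  define a where "a = \<alpha> 1 - 1"
  define P where "P i = (\<Sum>s = 1..i. \<gamma> s)" for i
  have P_Suc: "P (Suc i) = P i + \<gamma> (Suc i)" for i by (simp add: P_def)
  have P_0: "P 0 = 0" and P_r: "P r = l" by (simp_all add: P_def l height_def)
  have mono_P: "mono P" by (simp add: mono_iff_le_Suc P_Suc)
  \<comment> \<open>Consecutive intervals omit exactly one exponent, because \<alpha>_{i+1} =
    \<beta>_i + 2; in shifted form it is a partial sum.\<close>
  have ends: "\<alpha> (Suc i) = a + P i + 1 \<and> \<beta> (Suc i) + 1 = a + P (Suc i)" if "i < r" for i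
    using that
  proof (induction i)
    case 0
    then show ?case
      using \<alpha>1 \<alpha>\<beta>[of 1] \<gamma>[of 1] by (simp add: a_def P_Suc P_0 part_def)
  next
    case (Suc i)
    then show ?case
      using next_\<alpha>[of "Suc i"] \<alpha>\<beta>[of "Suc (Suc i)"] \<gamma>[of "Suc (Suc i)"]
      by (simp add: P_Suc[of "Suc i"] part_def)
  qed
  have P_less: "P i < P (Suc i)" if "i < r" for i
    using \<gamma>[of "Suc i"] that by (simp add: P_Suc part_def)
  have \<beta>r': "\<beta> r + 1 = a + l"
    using ends[of "r - 1"] r P_r by simp
  interpret gapped_monomials d l r a P T
  proof
    show "0 < a" using \<alpha>1 by (simp add: a_def)
    have "2 \<le> l" using assms(2) by simp
    then have "2 \<le> \<beta> r" using \<beta>r' \<alpha>1 unfolding a_def by linarith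
    then show "a + l < d" using \<beta>r \<beta>r' by linarith
  next
    fix m assume m: "m \<le> l" "m \<notin> P ` {0..r}"
    \<comment> \<open>The block containing \<open>m\<close> ends at the first border not below
      \<open>m\<close>; as \<open>m\<close> is no border, it lies strictly inside.\<close>
    define s where "s = (LEAST s. m \<le> P s)"
    have s: "m \<le> P s" "s \<le> r"
      unfolding s_def using m(1) P_r by (auto intro: LeastI Least_le)
    then have "m \<noteq> P s" "m \<noteq> P 0" using m(2) by auto
    then have "s \<noteq> 0" using s by (cases "s = 0") (auto simp: P_0)
    then obtain i where i: "s = Suc i" by (cases s) auto
    have "P i < m"
      using not_less_Least[of i "\<lambda>s. m \<le> P s"] i by (simp add: s_def not_le)
    then have "a + m \<in> {\<alpha> s..\<beta> s}"
      using ends[of i] s i \<open>m \<noteq> P s\<close> by auto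
    moreover have "s \<in> {1..r}" using s i by simp
    ultimately show "monom_xy (d - (a + m)) (a + m) \<in> T"
      unfolding T by (intro pm.span_base) blast
  next
    fix f i c assume f: "f \<in> T" and i: "i \<le> r"
    let ?S = "{f :: bpoly. Poly_Mapping.lookup f (c, a + P i) = 0}"
    have "T \<subseteq> ?S"
      unfolding T
    proof (rule pm.span_minimal)
      show "pm.subspace ?S"
        by (auto simp: pm.subspace_def lookup_add lookup_scal)
      \<comment> \<open>The border lies left of the interval \<open>s\<close> if
        \<open>i < s\<close> and right of it otherwise.\<close>
      have "j \<noteq> a + P i" if s: "s \<in> {1..r}" "j \<in> {\<alpha> s..\<beta> s}" for s j
      proof -
        obtain s' where s': "s = Suc s'" "s' < r" using s(1) by (cases s) auto
        show ?thesis
          using monoD[OF mono_P, of i s'] monoD[OF mono_P, of s i] ends[OF s'(2)] s s'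
          by (cases "i \<le> s'") auto
      qed
      then show "(\<lambda>j. monom_xy (d - j) j) ` (\<Union>i\<in>{1..r}. {\<alpha> i..\<beta> i}) \<subseteq> ?S"
        unfolding lookup_monom_xy by (fastforce simp: lookup_monom_xy)
    qed
    then show "Poly_Mapping.lookup f (c, a + P i) = 0" using f by auto
  qed (fact mono_P P_0 P_r)+
  have "d - Suc a = d - \<alpha> 1" "a + l - 1 = \<beta> r"
    using \<alpha>1 \<beta>r' unfolding a_def by linarith+
  then have h': "h = apex_form"
    by (simp add: h apex_def apex_form_def)
  \<comment> \<open>The block is \<open>{P i + 1..P (Suc i)}\<close>. The strict inequality records
    that it is nonempty, as an empty set would lie in every window.\<close>
  have block_iff: "block \<gamma> (Suc i) \<subseteq> {j + 1..j + k} \<longleftrightarrow>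
      P i < P (Suc i) \<and> j \<le> P i \<and> P (Suc i) \<le> j + k" if "i < r" for i j
  proof -
    have "block \<gamma> (Suc i) = {P i + 1..P (Suc i)}"
      by (simp add: block_def P_def atLeastLessThanSuc_atLeastAtMost)
    then show ?thesis using P_less[OF that] by auto
  qed
  have indices: "{1..r} = Suc ` {..<r}"
    by (auto simp: image_iff Suc_le_eq gr0_conv_Suc)
  have "(\<exists>i\<in>{1..r}. block \<gamma> i \<subseteq> {j + 1..j + k}) \<longleftrightarrow>
      (\<exists>i<r. P i < P (Suc i) \<and> j \<le> P i \<and> P (Suc i) \<le> j + k)" for j
    unfolding indices bex_simps(7) using block_iff by blast
  then show ?thesis
    using quot_dim_eq_card_covering[of k] assms(2)
    unfolding q_def covering_generators_def h' by simp
qed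

end
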